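(* Let $q$ be a prime power, let $W = [W_{ij}]_{1 \le i,j \le n}$ be a $\mathrm{CGW}(n,w;q+1)$, let $\alpha$ be a primitive $(q+1)$-th root of unity in $\mathbb{F}_{q^2}$, and let $f : \mathcal{U}_{q+1} \to \mathbb{F}_{q^2}$ be the map with $f(0)=0$ and $f(\zeta_{q+1}^{j}) = \alpha^{j}$ for $j = 0,1,\ldots,q$. Put $f(W) = [f(W_{ij})]_{1 \le i,j \le n}$. If $w$ is divisible by the characteristic of $\mathbb{F}_{q^2}$, then the rows of $f(W)$ generate a Hermitian self-orthogonal code over $\mathbb{F}_{q^2}$.
   Context: For a positive integer $k$, let $\zeta_k = e^{2\pi\sqrt{-1}/k}$ and $\mathcal{U}_k = \{0\} \cup \{\zeta_k^j : 0 \le j \le k-1\}$. A $\mathrm{CGW}(n,w;k)$ (complex generalized weighing matrix of order $n$ and weight $w$) is an $n \times n$ matrix $W$ with entries in $\mathcal{U}_k$ such that $WW^{*} = wI_n$, where $W^*$ is the complex conjugate transpose. A primitive $k$-th root of unity in a finite field is an element of multiplicative order exactly $k$. The code generated by a matrix over $\mathbb{F}_{q^2}$ is its row space (an $\mathbb{F}_{q^2}$-linear subspace of $\mathbb{F}_{q^2}^n$). The Hermitian inner product on $\mathbb{F}_{q^2}^n$ is $\langle x,y\rangle_H = \sum_{i} x_i y_i^{q}$. A linear code $C \subseteq \mathbb{F}_{q^2}^n$ is Hermitian self-orthogonal if $C \subseteq C^H = \{x \in \mathbb{F}_{q^2}^n : \langle x,y\rangle_H = 0 \text{ for all } y \in C\}$,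 i.e. $\langle x,y\rangle_H=0$ for all $x,y\in C$. *)

theory Defs
  imports
    "HOL-Analysis.Analysis"
    "HOL-Number_Theory.Prime_Powers"
begin

definition zeta :: "nat \<Rightarrow> complex" where
  "zeta k = exp (2 * of_real pi * \<i> / of_nat k)"

definition unity_roots0 :: "nat \<Rightarrow> complex set" where
  "unity_roots0 k = insert 0 {zeta k ^ j | j. j < k}"

definition conj_transpose :: "complex^'n^'m \<Rightarrow> complex^'m^'n" where
  "conj_transpose A = transpose (map_matrix cnj A)"

text \<open>The order \<open>n\<close> of the matrix is the cardinality of the index type \<open>'n\<close>.\<close>

definition CGW :: "nat \<Rightarrow> nat \<Rightarrow> complex^'n^'n \<Rightarrow> bool" where
  "CGW w k W \<longleftrightarrow>
     k > 0 \<and> (\<forall>i j. W $ i $ j \<in> unity_roots0 k) \<and> W ** conj_transpose W = mat (of_nat w)"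

definition primitive_root_of_unity :: "nat \<Rightarrow> 'a::field \<Rightarrow> bool" where
  "primitive_root_of_unity k a \<longleftrightarrow>
     k > 0 \<and> a ^ k = 1 \<and> (\<forall>j. 0 < j \<and> j < k \<longrightarrow> a ^ j \<noteq> 1)"

definition row_code :: "'a::field^'n^'m \<Rightarrow> ('a^'n) set" where
  "row_code A = vec.span (rows A)"

text \<open>
  The parameter \<open>q\<close> of the Hermitian notions is the square root of the number of elements of the
  field; this is not part of the definitions, it has to be imposed where they are used.
\<close>

definition hermitian_inner :: "nat \<Rightarrow> 'a::field^'n \<Rightarrow> 'a^'n \<Rightarrow> 'a" where
  "hermitian_inner q x y = (\<Sum>i\<in>UNIV. x $ i * (y $ i) ^ q)"

definition hermitian_dual :: "nat \<Rightarrow> ('a::field^'n) set \<Rightarrow> ('a^'n) set" where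
  "hermitian_dual q C = {x. \<forall>y\<in>C. hermitian_inner q x y = 0}"

definition hermitian_self_orthogonal :: "nat \<Rightarrow> ('a::field^'n) set \<Rightarrow> bool" where
  "hermitian_self_orthogonal q C \<longleftrightarrow> vec.subspace C \<and> C \<subseteq> hermitian_dual q C"

end

theory Submission
  imports
    Defs
    "HOL-Computational_Algebra.Computational_Algebra"
    "HOL-Number_Theory.Cong"
begin

text \<open>
  A product \<open>W\<^sub>r\<^sub>i * cnj W\<^sub>s\<^sub>i\<close> of nonzero entries is a power of \<open>\<zeta> = zeta (q + 1)\<close>, because
  \<open>cnj \<zeta> = \<zeta> ^ q\<close>, and applying \<open>f\<close> replaces \<open>\<zeta>\<close> by \<open>\<alpha>\<close> in it. So orthogonality of the rows of \<open>W\<close>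
  is an integer polynomial relation for \<open>\<zeta>\<close>, and it suffices that such relations also hold for
  \<open>\<alpha>\<close>. Let \<open>g\<close> be a prime factor of \<open>x ^ k - 1\<close> in \<open>\<int>[x]\<close> that vanishes at \<open>\<alpha>\<close>, where \<open>k = q + 1\<close>. Its
  complex roots are primitive \<open>k\<close>-th roots of unity, since otherwise \<open>g\<close> divides \<open>x ^ d - 1\<close> for
  some \<open>0 < d < k\<close>, which does not vanish at \<open>\<alpha>\<close>. By Dedekind's argument for the irreducibility
  of the cyclotomic polynomials, \<open>\<zeta>\<close> is a root of \<open>g\<close>, so \<open>g\<close> divides every relation for \<open>\<zeta>\<close>.
\<close>

section \<open>Integer polynomials evaluated in a commutative ring\<close>

text \<open>Keeping the coefficients in \<open>int\<close> lets one polynomial be evaluated both at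
  complex numbers and in a finite field.\<close>

definition ieval :: "int poly \<Rightarrow> 'a::comm_ring_1 \<Rightarrow> 'a" where
  "ieval P x = poly (map_poly of_int P) x"

lemma ieval_0 [simp]: "ieval 0 x = 0"
  by (simp add: ieval_def)

lemma ieval_pCons [simp]: "ieval (pCons c P) x = of_int c + x * ieval P x"
  by (simp add: ieval_def map_poly_pCons)

lemma ieval_1 [simp]: "ieval 1 x = 1"
  by (simp add: one_pCons)

lemma ieval_add [simp]: "ieval (P + Q) x = ieval P x + ieval Q x"
  by (induction P Q rule: poly_induct2) (simp_all add: algebra_simps)

lemma ieval_smult [simp]: "ieval (smult c P) x = of_int c * ieval P x"
  by (induction P) (simp_all add: algebra_simps)

lemma ieval_diff [simp]: "ieval (P - Q) x = ieval P x - ieval Q x"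
  using ieval_add[of "P - Q" Q x] by (simp add: algebra_simps)

lemma ieval_mult [simp]: "ieval (P * Q) x = ieval P x * ieval Q x"
  by (induction P) (simp_all add: algebra_simps)

lemma ieval_power [simp]: "ieval (P ^ n) x = ieval P x ^ n"
  by (induction n) simp_all

lemma ieval_monom [simp]: "ieval (monom c n) x = of_int c * x ^ n"
  by (induction n) (simp_all add: monom_0 monom_Suc algebra_simps)

lemma ieval_sum [simp]: "ieval (\<Sum>i\<in>A. P i) x = (\<Sum>i\<in>A. ieval (P i) x)"
  by (induction A rule: infinite_finite_induct) simp_all

lemma ieval_pcompose [simp]: "ieval (pcompose P Q) x = ieval P (ieval Q x)"
  by (induction P) (simp_all add: pcompose_pCons)

text \<open>A product vanishes in a domain only if a factor does, and units of
  \<open>int poly\<close> never vanish. The factor \<open>g\<close> may still be constant, for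
  example the characteristic.\<close>

lemma ieval_root_prime_factor:
  fixes a :: "'a::idom"
  assumes "P \<noteq> 0" "ieval P a = 0"
  obtains g where "prime g" "g dvd P" "ieval g a = 0"
proof -
  have "\<exists>g. prime g \<and> g dvd P \<and> ieval g a = 0"
    using assms
  proof (induction P rule: prime_divisors_induct)
    case (unit P)
    then obtain Q where "1 = P * Q"
      by (auto elim: dvdE)
    then have "ieval 1 a = ieval P a * ieval Q a"
      by (metis ieval_mult)
    with unit.prems show ?case by simp
  next
    case (factor p P)
    from factor.prems have "ieval p a = 0 \<or> ieval P a = 0" "P \<noteq> 0" by auto
    with factor show ?case by (meson dvd_mult dvd_triv_left)
  qed simp
  then show ?thesis using that by blast
qed

text \<open>A nonzero \<open>D\<close> of least degree vanishing at \<open>z\<close> serves as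
  minimal polynomial. By pseudo-division it divides a nonzero integer multiple of every relation;
  primality of \<open>g\<close> then removes the integer.\<close>

lemma prime_dvd_if_common_root:
  fixes z :: "'a::field_char_0"
  assumes g: "prime_elem g" "degree g > 0" "ieval g z = 0" and P: "ieval P z = 0"
  shows "g dvd P"
proof -
  define S where "S = (\<lambda>D. D \<noteq> 0 \<and> ieval D z = 0)"
  have "S g" using g by (auto simp: S_def)
  define D where "D = arg_min degree S"
  have D: "D \<noteq> 0" "ieval D z = 0"
    using arg_min_natI[of S g degree] \<open>S g\<close> by (auto simp: S_def D_def)
  have min: "degree D \<le> degree E" if "E \<noteq> 0" "ieval E z = 0" for E
    using arg_min_nat_le[of S E degree] that by (auto simp: S_def D_def)
  have D_dvd: "\<exists>c. c \<noteq> 0 \<and> D dvd smult c E" if "ieval E z = 0" for E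
  proof -
    define r where "r = pseudo_mod E D"
    obtain c q where cq: "c \<noteq> 0" "smult c E = D * q + r"
      using pseudo_mod(1)[OF D(1), of E] by (auto simp: r_def)
    have "ieval (smult c E) z = ieval (D * q + r) z" using cq by simp
    then have "ieval r z = 0" using that D by simp
    then have "r = 0"
      using pseudo_mod(2)[OF D(1), of E] min[of r] unfolding r_def by linarith
    with cq show ?thesis by auto
  qed
  obtain c Q where c: "c \<noteq> 0" "smult c g = D * Q"
    using D_dvd[OF g(3)] by (meson dvdE)
  have "g dvd D * Q" using c(2) by (metis dvd_refl dvd_smult)
  then consider "g dvd D" | "g dvd Q" using prime_elem_dvd_mult_iff[OF g(1)] by blast
  then have "g dvd D"
  proof cases
    \<comment> \<open>Cancelling \<open>g\<close> would make \<open>D\<close> a nonzero constant,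
      which cannot vanish at \<open>z\<close> in characteristic 0.\<close>
    case 2
    then obtain R where "Q = g * R" by (auto elim: dvdE)
    with c(2) have "g * [:c:] = g * (D * R)" by (simp add: algebra_simps)
    then have *: "[:c:] = D * R" using g(2) by (subst (asm) mult_left_cancel) auto
    then have "R \<noteq> 0" using c(1) by auto
    then have "degree D = 0"
      using * D(1) degree_mult_eq[of D R] by (metis add_is_0 degree_pCons_0)
    then obtain d where "D = [:d:]" by (auto elim: degree_eq_zeroE)
    with D show ?thesis by simp
  qed
  moreover obtain b where b: "b \<noteq> 0" "D dvd smult b P" using D_dvd[OF P] by blast
  ultimately have "g dvd [:b:] * P" by (auto intro: dvd_trans)
  moreover have "\<not> g dvd [:b:]"
    using g(2) b(1) dvd_imp_degree_le[of g "[:b:]"] by auto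
  ultimately show ?thesis using prime_elem_dvd_mult_iff[OF g(1)] by blast
qed

text \<open>Reducing \<open>B\<close> modulo \<open>m\<close> costs only the unit \<open>u\<close>.
  What remains is a multiple of \<open>m\<close> of smaller degree, hence zero, and its constant
  coefficient gives the claim.\<close>

lemma dvd_const_minus_smult_imp_dvd:
  fixes m B :: "int poly"
  assumes m: "is_unit (lead_coeff m)" "degree m > 0" and dvd: "m dvd [:c:] - smult p B"
  shows "p dvd c"
proof -
  obtain q r where qr: "pseudo_divmod B m = (q, r)" by force
  define u where "u = lead_coeff m ^ (Suc (degree B) - degree m)"
  have u: "is_unit u" unfolding u_def using m(1) is_unit_power_iff by blast
  have "m \<noteq> 0" using m(2) by auto
  from pseudo_divmod[OF this qr] have B: "smult u B = m * q + r" and r: "r = 0 \<or> degree r < degree m"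
    by (auto simp: u_def)
  have "[:u * c:] - smult p r = smult u ([:c:] - smult p B) + smult p (m * q)"
    using arg_cong[OF B, of "smult p"] by (simp add: algebra_simps smult_add_right smult_diff_right)
  then have "m dvd [:u * c:] - smult p r"
    using dvd by (simp add: dvd_smult)
  moreover have "degree ([:u * c:] - smult p r) < degree m"
    using r m(2) by (intro degree_diff_less) auto
  ultimately have "[:u * c:] - smult p r = 0"
    using dvd_imp_degree_le leD by blast
  then have "coeff [:u * c:] 0 = coeff (smult p r) 0" by simp
  then have "p dvd u * c" by simp
  then show ?thesis using u by (simp add: dvd_mult_unit_iff')
qed

lemma lead_coeff_monom_diff_1:
  "k > 0 \<Longrightarrow> lead_coeff (monom 1 k - 1 :: 'a::comm_ring_1 poly) = 1"
  using lead_coeff_add_le[of "- 1" "monom 1 k :: 'a poly"] by (simp add: degree_monom_eq)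

lemma is_unit_lead_coeff_factor:
  fixes m :: "int poly"
  assumes "k > 0" "m dvd monom 1 k - 1"
  shows "is_unit (lead_coeff m)"
  using assms lead_coeff_monom_diff_1[of k, where ?'a = int]
  by (metis dvdE dvd_triv_left lead_coeff_mult)

section \<open>Irreducibility of the cyclotomic polynomials\<close>

text \<open>Modulo \<open>p\<close>, the \<open>p\<close>-th power is additive
  (\<open>dream\<close>) and fixes integers (\<open>const\<close>, Fermat), so it only replaces x by
  x^p.\<close>

lemma int_poly_frobenius_cong:
  assumes p: "prime p"
  obtains S :: "int poly" where "H ^ p = pcompose H (monom 1 p) + smult (int p) S"
proof -
  have dream: "[:int p:] dvd (a + b) ^ p - (a ^ p + b ^ p)" for a b :: "int poly"
  proof -
    have p0: "p > 0" using p prime_gt_0_nat by blast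
    have "(a + b) ^ p = (\<Sum>j\<le>p. of_nat (p choose j) * a ^ j * b ^ (p - j))"
      by (rule binomial_ring)
    also have "\<dots> = (\<Sum>j\<in>{..p} - {0,p}. of_nat (p choose j) * a ^ j * b ^ (p - j))
        + (\<Sum>j\<in>{0,p}. of_nat (p choose j) * a ^ j * b ^ (p - j))"
      by (rule sum.subset_diff) auto
    finally have "(a + b) ^ p - (a ^ p + b ^ p)
        = (\<Sum>j\<in>{..p} - {0,p}. of_nat (p choose j) * a ^ j * b ^ (p - j))"
      using p0 by simp
    moreover have "[:int p:] dvd of_nat (p choose j) * a ^ j * b ^ (p - j)"
      if "j \<in> {..p} - {0,p}" for j
    proof -
      have "p dvd (p choose j)"
        by (rule dvd_choose_prime) (use that p in auto)
      then have "[:int p:] dvd of_nat (p choose j)"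
        by (auto simp: of_nat_poly const_poly_dvd_const_poly_iff)
      then show ?thesis by (simp add: dvd_mult2)
    qed
    ultimately show ?thesis by (metis (no_types, lifting) dvd_sum)
  qed
  have const: "int p dvd c ^ p - c" for c
  proof -
    have "[c ^ p = c] (mod int p)"
    proof (induction c rule: int_induct[where k = 0])
      case base
      show ?case using p prime_gt_0_nat[OF p] by (simp add: power_0_left)
    next
      case (step1 c)
      have "[:int p:] dvd ([:c:] + 1) ^ p - ([:c:] ^ p + 1 ^ p)" by (rule dream)
      then have "int p dvd (c + 1) ^ p - (c ^ p + 1)"
        by (simp add: one_pCons poly_const_pow const_poly_dvd_const_poly_iff)
      then have "[(c + 1) ^ p = c ^ p + 1] (mod int p)" by (simp add: cong_iff_dvd_diff)
      then show ?case using step1 by (meson cong_add_rcancel cong_trans)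
    next
      case (step2 c)
      have "[:int p:] dvd ([:c - 1:] + 1) ^ p - ([:c - 1:] ^ p + 1 ^ p)" by (rule dream)
      then have "int p dvd c ^ p - ((c - 1) ^ p + 1)"
        by (simp add: one_pCons poly_const_pow const_poly_dvd_const_poly_iff)
      then have "[c ^ p = (c - 1) ^ p + 1] (mod int p)" by (simp add: cong_iff_dvd_diff)
      then have "[(c - 1) ^ p + 1 = (c - 1) + 1] (mod int p)"
        using step2 by (metis cong_sym cong_trans diff_add_cancel)
      then show ?case by (meson cong_add_rcancel)
    qed
    then show ?thesis by (simp add: cong_iff_dvd_diff)
  qed
  have "[:int p:] dvd H ^ p - pcompose H (monom 1 p)"
  proof (induction H)
    case 0
    then show ?case using prime_gt_0_nat[OF p] by (simp add: power_0_left)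
  next
    case (pCons c H)
    define X :: "int poly" where "X = monom 1 1"
    have eq: "pCons c H = [:c:] + X * H"
      by (simp add: X_def monom_Suc monom_0)
    have Xp: "X ^ p = monom 1 p" by (simp add: X_def monom_power)
    have "pCons c H ^ p - pcompose (pCons c H) (monom 1 p)
       = (([:c:] + X * H) ^ p - ([:c:] ^ p + (X * H) ^ p)) + ([:c:] ^ p - [:c:])
          + X ^ p * (H ^ p - pcompose H (monom 1 p))"
      unfolding pcompose_pCons Xp[symmetric] by (simp only: eq) (simp add: algebra_simps)
    moreover have "[:int p:] dvd [:c:] ^ p - [:c:]"
      using const by (simp add: poly_const_pow const_poly_dvd_const_poly_iff)
    ultimately show ?case using dream[of "[:c:]" "X * H"] pCons.IH by (metis dvd_add dvd_mult)
  qed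
  then obtain S where "H ^ p - pcompose H (monom 1 p) = [:int p:] * S" by (auto elim: dvdE)
  then show ?thesis using that[of S] by (simp add: algebra_simps)
qed

text \<open>
  If \<open>x ^ k - 1 = m h\<close> and \<open>h\<close> vanished at \<open>z ^ p\<close>, then \<open>h(z) ^ p\<close> would be divisible by \<open>p\<close> in
  \<open>\<int>[z]\<close>; differentiating gives \<open>k = z m'(z) h(z)\<close>, so \<open>p\<close> would divide \<open>k ^ p\<close> there.
\<close>

lemma root_prime_power:
  fixes z :: "'a::field_char_0"
  assumes m: "prime_elem m" "degree m > 0" "m dvd monom 1 k - 1" and z: "ieval m z = 0"
    and k: "k > 0" and p: "prime p" "\<not> p dvd k"
  shows "ieval m (z ^ p) = 0"
proof (rule ccontr)
  assume nz: "ieval m (z ^ p) \<noteq> 0"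
  obtain h where h: "monom 1 k - 1 = m * h" using m(3) by (auto elim: dvdE)
  have ev: "x ^ k - 1 = ieval m x * ieval h x" for x :: 'a
    using arg_cong[OF h, of "\<lambda>P. ieval P x"] by simp
  have zk: "z ^ k = 1" using ev[of z] z by simp
  have "(z ^ p) ^ k = 1" using zk by (metis power_mult mult.commute power_one)
  then have hz: "ieval h (z ^ p) = 0" using ev[of "z ^ p"] nz by simp
  obtain S where S: "h ^ p = pcompose h (monom 1 p) + smult (int p) S"
    using int_poly_frobenius_cong[OF p(1)] .
  have hS: "ieval h z ^ p = of_nat p * ieval S z"
    using arg_cong[OF S, of "\<lambda>P. ieval P z"] hz by simp
  have "pderiv (monom 1 k - 1) = m * pderiv h + h * pderiv m"
    by (simp add: h pderiv_mult)
  then have "monom (int k) (k - 1) = m * pderiv h + h * pderiv m"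
    by (simp add: pderiv_diff pderiv_monom)
  from arg_cong[OF this, of "\<lambda>P. ieval P z"]
  have "of_nat k * z ^ (k - 1) = ieval h z * ieval (pderiv m) z"
    using z by simp
  then have "of_nat k = z * ieval h z * ieval (pderiv m) z"
    using zk k by (metis mult.left_commute mult.right_neutral mult.assoc power_eq_if not_gr0)
  then have "of_nat k ^ p = of_nat p * (z ^ p * ieval S z * ieval (pderiv m) z ^ p)"
    by (simp add: power_mult_distrib hS algebra_simps)
  \<comment> \<open>Lifting the relation from \<int>[z] to a multiple of \<open>m\<close> allows
    descent to \<int>, since \<open>m\<close> has unit leading coefficient.\<close>
  then have "ieval ([:int k ^ p:] - smult (int p) (monom 1 p * S * pderiv m ^ p)) z = 0"
    by (simp add: algebra_simps)
  then have dvd: "m dvd [:int k ^ p:] - smult (int p) (monom 1 p * S * pderiv m ^ p)"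
    by (intro prime_dvd_if_common_root[OF m(1,2) z])
  have "is_unit (lead_coeff m)" using is_unit_lead_coeff_factor[OF k m(3)] .
  then have "int p dvd int k ^ p" using dvd_const_minus_smult_imp_dvd[OF _ m(2) dvd] by blast
  then have "p dvd k ^ p" by (metis of_nat_dvd_iff of_nat_power)
  with p show False using prime_dvd_power by blast
qed

text \<open>The prime factors of \<open>j\<close> are peeled off one by one. Each step replaces
  \<open>z\<close> by \<open>z ^ p\<close>, hence the induction over arbitrary
  \<open>z\<close>.\<close>

lemma root_coprime_power:
  fixes z :: "'a::field_char_0"
  assumes m: "prime_elem m" "degree m > 0" "m dvd monom 1 k - 1" and k: "k > 0"
    and z: "ieval m z = 0" and "j > 0" "coprime j k"
  shows "ieval m (z ^ j) = 0"
  using z \<open>j > 0\<close> \<open>coprime j k\<close>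
proof (induction j arbitrary: z rule: prime_divisors_induct)
  case (factor p j)
  have "\<not> p dvd k"
    using factor.prems factor.hyps
    by (metis coprime_common_divisor dvd_triv_left not_prime_unit)
  then have "ieval m (z ^ p) = 0"
    using root_prime_power[OF m factor.prems(1) k] factor.hyps by blast
  then have "ieval m ((z ^ p) ^ j) = 0"
    using factor by (intro factor.IH) auto
  then show ?case by (simp add: power_mult)
qed auto

section \<open>Transfer of relations between roots of unity\<close>

lemma zeta_power: "zeta k ^ j = exp (2 * of_real pi * \<i> * of_nat j / of_nat k)"
  by (simp add: zeta_def flip: exp_of_nat2_mult)

lemma zeta_power_self: "k > 0 \<Longrightarrow> zeta k ^ k = 1"
  by (simp add: zeta_power)

theorem zeta_relation_transfer:
  fixes a :: "'a::idom"
  assumes k: "k > 0" and a: "a ^ k = 1" "\<And>d. 0 < d \<Longrightarrow> d < k \<Longrightarrow> a ^ d \<noteq> 1"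
    and P: "ieval P (zeta k) = 0"
  shows "ieval P a = 0"
proof -
  have "(monom 1 k - 1 :: int poly) \<noteq> 0"
    using lead_coeff_monom_diff_1[OF k, where ?'a = int] by (metis leading_coeff_0_iff zero_neq_one)
  moreover have "ieval (monom 1 k - 1) a = 0" using a by simp
  ultimately obtain g where g: "prime g" "g dvd monom 1 k - 1" "ieval g a = 0"
    by (rule ieval_root_prime_factor)
  have pe: "prime_elem g" using g(1) by simp
  have lcg: "is_unit (lead_coeff g)" using is_unit_lead_coeff_factor[OF k g(2)] .
  \<comment> \<open>A constant \<open>g\<close> would equal its unit leading coefficient, so it
    could not be prime.\<close>
  have deg: "degree g > 0"
  proof (rule ccontr)
    assume "\<not> degree g > 0"
    then obtain c where "g = [:c:]" by (auto elim: degree_eq_zeroE)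
    with lcg have "is_unit g" by (simp add: is_unit_const_poly_iff)
    with g(1) show False by (simp add: not_prime_unit)
  qed
  have "\<not> constant (poly (map_poly of_int g :: complex poly))"
    using deg by (simp add: constant_degree degree_map_poly)
  then obtain z :: complex where z: "ieval g z = 0"
    using fundamental_theorem_of_algebra by (auto simp: ieval_def)
  \<comment> \<open>The order of \<open>a\<close> controls that of \<open>z\<close>: as
    \<open>g\<close> vanishes at both, \<open>z ^ d = 1\<close> would force
    \<open>a ^ d = 1\<close>.\<close>
  have zd: "z ^ d \<noteq> 1" if "0 < d" "d < k" for d
  proof
    assume "z ^ d = 1"
    then have "ieval (monom 1 d - 1) z = 0" by simp
    then have "g dvd monom 1 d - 1" by (rule prime_dvd_if_common_root[OF pe deg z])
    then obtain Q where "monom 1 d - 1 = g * Q" by (auto elim: dvdE)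
    from arg_cong[OF this, of "\<lambda>P. ieval P a"] have "a ^ d = 1" using g(3) by simp
    with a that show False by blast
  qed
  have "z ^ k = 1"
  proof -
    obtain Q where "monom 1 k - 1 = g * Q" using g(2) by (auto elim: dvdE)
    from arg_cong[OF this, of "\<lambda>P. ieval P z"] show ?thesis using z by simp
  qed
  then obtain j where j: "z = zeta k ^ j"
    using complex_roots_unity[of k] k by (auto simp: zeta_power)
  have cop: "coprime j k"
  proof -
    define d where "d = gcd j k"
    have "d > 0" using k by (simp add: d_def)
    obtain j' k' where jk: "j = d * j'" "k = d * k'" by (metis d_def gcd_dvd1 gcd_dvd2 dvdE)
    have "z ^ k' = (zeta k ^ k) ^ j'" by (simp add: j flip: power_mult) (simp add: jk mult_ac)
    then have "z ^ k' = 1" using zeta_power_self[OF k] by simp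
    moreover have "k' > 0" using jk k by (cases k') auto
    ultimately have "\<not> k' < k" using zd by blast
    then have "d = 1" using jk \<open>d > 0\<close> \<open>k' > 0\<close> by (cases "d = 1") auto
    then show ?thesis by (simp add: d_def coprime_iff_gcd_eq_1)
  qed
  obtain i where i: "[j * i = 1] (mod k)" using cong_solve_coprime_nat[OF cop] by auto
  \<comment> \<open>Adding \<open>k\<close> keeps the inverse of \<open>j\<close> modulo
    \<open>k\<close> and makes it positive. Raising \<open>z\<close> to it recovers
    \<open>zeta k\<close>.\<close>
  define i' where "i' = i + k"
  have i': "[j * i' = 1] (mod k)" using i by (simp add: i'_def cong_def distrib_left)
  then have "coprime i' k" by (metis coprime_1_left coprime_mult_left_iff cong_imp_coprime cong_sym)
  moreover have "i' > 0" using k by (simp add: i'_def)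
  ultimately have "ieval g (z ^ i') = 0"
    by (intro root_coprime_power[OF pe deg g(2) k z])
  moreover have "z ^ i' = zeta k"
  proof -
    have per: "zeta k ^ n = zeta k ^ (n mod k)" for n
    proof -
      have "zeta k ^ n = zeta k ^ (k * (n div k) + n mod k)" by simp
      also have "\<dots> = zeta k ^ (n mod k)"
        by (simp only: power_add power_mult zeta_power_self[OF k] power_one mult_1)
      finally show ?thesis .
    qed
    have "z ^ i' = zeta k ^ (j * i')" by (simp add: j power_mult)
    also have "\<dots> = zeta k ^ 1" using i' per[of "j * i'"] per[of 1] by (simp add: cong_def)
    finally show ?thesis by simp
  qed
  ultimately have "g dvd P" by (intro prime_dvd_if_common_root[OF pe deg _ P]) simp
  then obtain Q where "P = g * Q" by (auto elim: dvdE)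
  then show ?thesis using g(3) by simp
qed

section \<open>Hermitian inner products\<close>

text \<open>By \<open>frob\<close> the form is additive in its second argument too, so orthogonality
  extends from rows to their span, one argument at a time.\<close>

lemma hermitian_self_orthogonal_row_code:
  fixes A :: "'a::field^'n^'m"
  assumes frob: "\<And>x y :: 'a. (x + y) ^ q = x ^ q + y ^ q" and q: "q > 0"
    and rows: "\<And>r s. hermitian_inner q (A $ r) (A $ s) = 0"
  shows "hermitian_self_orthogonal q (row_code A)"
proof -
  have add1: "hermitian_inner q (x + x') y = hermitian_inner q x y + hermitian_inner q x' y"
    and scale1: "hermitian_inner q (c *s x) y = c * hermitian_inner q x y"
    and add2: "hermitian_inner q x (y + y') = hermitian_inner q x y + hermitian_inner q x y'"
    and scale2: "hermitian_inner q x (c *s y) = c ^ q * hermitian_inner q x y"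
    and zero: "hermitian_inner q 0 y = 0" "hermitian_inner q x 0 = 0"
    for x x' y y' :: "'a^'n" and c
    using q by (simp_all add: hermitian_inner_def frob distrib_left distrib_right sum.distrib
        sum_distrib_left power_mult_distrib mult_ac power_0_left)
  have rows_eq: "rows A = range (\<lambda>r. A $ r)" by (auto simp: rows_def row_def)
  have left: "hermitian_inner q x (A $ s) = 0" if "x \<in> vec.span (rows A)" for x s
    using that
  proof (induction rule: vec.span_induct_alt)
    case (step c x y)
    then show ?case using rows by (auto simp: add1 scale1 rows_eq)
  qed (rule zero)
  have "hermitian_inner q x y = 0" if x: "x \<in> vec.span (rows A)" and y: "y \<in> vec.span (rows A)" for x y
    using y
  proof (induction rule: vec.span_induct_alt)
    case (step c y y')
    then show ?case using left[OF x] by (auto simp: add2 scale2 rows_eq)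
  qed (rule zero)
  then show ?thesis
    by (auto simp: hermitian_self_orthogonal_def hermitian_dual_def row_code_def)
qed

theorem proposition4p4:
  fixes q w :: nat
    and W :: "complex^'n^'n"
    and \<alpha> :: "'a::finite_field"
    and f :: "complex \<Rightarrow> 'a"
  assumes "primepow q"
    and "CARD('a) = q ^ 2"
    and "CGW w (q + 1) W"
    and "primitive_root_of_unity (q + 1) \<alpha>"
    and "f 0 = 0"
    and "\<And>j. j \<le> q \<Longrightarrow> f (zeta (q + 1) ^ j) = \<alpha> ^ j"
    and "CHAR('a) dvd w"
  shows "hermitian_self_orthogonal q (row_code (map_matrix f W))"
proof -
  obtain p e where pe: "prime p" "q = p ^ e" using assms(1) by (auto simp: primepow_def)
  have q0: "q > 0" using assms(1) primepow_gt_0_nat by blast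
  have prime_char: "prime CHAR('a)"
    using finite_imp_CHAR_pos[where ?'a = 'a] prime_CHAR_semidom[where ?'a = 'a] by simp
  \<comment> \<open>Translation by 1 permutes the field, so its cardinality is zero in it.\<close>
  have "(\<Sum>x\<in>UNIV. x :: 'a) = (\<Sum>x\<in>UNIV. x + 1)"
    by (rule sum.reindex_bij_witness[of _ "\<lambda>x. x + 1" "\<lambda>x. x - 1"]) auto
  then have "of_nat (q ^ 2) = (0 :: 'a)"
    by (simp add: sum.distrib flip: assms(2))
  then have "CHAR('a) dvd q ^ 2" by (simp only: of_nat_eq_0_iff_char_dvd)
  then have "CHAR('a) dvd p"
    unfolding pe(2) using prime_char prime_dvd_power by blast
  then have p: "p = CHAR('a)" using pe(1) prime_char primes_dvd_imp_eq by blast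
  have frob: "(x + y) ^ q = x ^ q + y ^ q" for x y :: 'a
    by (rule freshmans_dream'[OF prime_char]) (use pe p in auto)
  have \<alpha>: "\<alpha> ^ (q + 1) = 1" "\<And>d. 0 < d \<Longrightarrow> d < q + 1 \<Longrightarrow> \<alpha> ^ d \<noteq> 1"
    using assms(4) by (auto simp: primitive_root_of_unity_def)
  define \<zeta> where "\<zeta> = zeta (q + 1)"
  have \<zeta>: "\<zeta> ^ (q + 1) = 1" unfolding \<zeta>_def by (rule zeta_power_self) simp
  have cnj: "cnj \<zeta> = \<zeta> ^ q"
  proof -
    have "\<zeta> * cnj \<zeta> = 1"
      by (simp add: \<zeta>_def zeta_def exp_cnj flip: exp_add)
    moreover have "\<zeta> * \<zeta> ^ q = 1" "\<zeta> \<noteq> 0" using \<zeta> by auto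
    ultimately show ?thesis by (metis mult_left_cancel)
  qed
  \<comment> \<open>\<open>M z\<close> represents \<open>z\<close> at \<zeta> and \<open>f z\<close>
    at \<alpha>. An exponent at most \<open>q\<close> is chosen to match the assumption on
    \<open>f\<close>.\<close>
  define M :: "complex \<Rightarrow> int poly"
    where "M z = (if z = 0 then 0 else monom 1 (LEAST j. j \<le> q \<and> z = \<zeta> ^ j))" for z
  have M: "ieval (M z) \<zeta> = z" "ieval (M z) (\<zeta> ^ q) = cnj z"
    "ieval (M z) \<alpha> = f z" "ieval (M z) (\<alpha> ^ q) = f z ^ q"
    if "z \<in> unity_roots0 (q + 1)" for z
  proof -
    have "ieval (M z) \<zeta> = z \<and> ieval (M z) (\<zeta> ^ q) = cnj z \<and>
      ieval (M z) \<alpha> = f z \<and> ieval (M z) (\<alpha> ^ q) = f z ^ q"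
    proof (cases "z = 0")
      case True
      then show ?thesis using assms(5) q0 by (simp add: M_def)
    next
      case False
      define j where "j = (LEAST j. j \<le> q \<and> z = \<zeta> ^ j)"
      from False that have "\<exists>j. j \<le> q \<and> z = \<zeta> ^ j"
        by (auto simp: unity_roots0_def \<zeta>_def less_Suc_eq_le)
      then have j: "j \<le> q" "z = \<zeta> ^ j" unfolding j_def by (metis (mono_tags, lifting) LeastI)+
      have "f z = \<alpha> ^ j" using assms(6)[OF j(1)] j(2) by (simp add: \<zeta>_def)
      moreover have "M z = monom 1 j" using False by (simp add: M_def j_def)
      moreover have "(x ^ q) ^ j = (x ^ j) ^ q" for x :: "'b::comm_monoid_mult"
        by (metis mult.commute power_mult)
      ultimately show ?thesis by (simp add: j(2) cnj)
    qed
    then show "ieval (M z) \<zeta> = z" "ieval (M z) (\<zeta> ^ q) = cnj z"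
      "ieval (M z) \<alpha> = f z" "ieval (M z) (\<alpha> ^ q) = f z ^ q" by auto
  qed
  have W: "W $ i $ j \<in> unity_roots0 (q + 1)" and WW: "W ** conj_transpose W = mat (of_nat w)" for i j
    using assms(3) by (auto simp: CGW_def)
  have "hermitian_inner q (map_matrix f W $ r) (map_matrix f W $ s) = 0" for r s
  proof -
    define c where "c = (if r = s then w else 0)"
    \<comment> \<open>Substituting x^q gives conjugation at \<zeta> and the \<open>q\<close>-th
      power at \<alpha>. Thus \<open>P\<close> encodes the row relation at \<zeta> and the Hermitian
      inner product, minus \<open>c\<close>, at \<alpha>.\<close>
    define P where "P = (\<Sum>i\<in>UNIV. M (W $ r $ i) * pcompose (M (W $ s $ i)) (monom 1 q)) - [:int c:]"
    have "(W ** conj_transpose W) $ r $ s = of_nat c" by (simp add: WW mat_def c_def)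
    then have "(\<Sum>i\<in>UNIV. W $ r $ i * cnj (W $ s $ i)) = of_nat c"
      by (simp add: matrix_matrix_mult_def conj_transpose_def transpose_def)
    then have "ieval P \<zeta> = 0" by (simp add: P_def M[OF W])
    then have "ieval P \<alpha> = 0"
      using zeta_relation_transfer[of "q + 1" \<alpha> P] \<alpha> by (simp add: \<zeta>_def)
    moreover have "of_nat c = (0 :: 'a)"
      using assms(7) by (simp add: c_def of_nat_eq_0_iff_char_dvd)
    ultimately show ?thesis
      by (simp add: P_def M[OF W] hermitian_inner_def)
  qed
  then show ?thesis by (rule hermitian_self_orthogonal_row_code[OF frob q0])
qed

end
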